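(* Let $G$ be either the De Bruijn digraph $B(d,D)$ or the Kautz digraph $K(d,D)$, with vertex set $V$, and assume $d=2$. Let $v=v_1\cdots v_D\in V$, $w=w_1\cdots w_D\in S_1(v)$, and let $1\le i\le D$. Then: (1) If $i=j=D$, then $S_{i}^\star(v) \cap S_{j}^{\star}(w)\ne\emptyset$ if and only if $G=K(d,D)$ or $v_D=w_D$. (2) If $D\ge j\ge i\ne D$, then $S_{i}^\star(v) \cap S_{j}^{\star}(w)\ne\emptyset$ if and only if $S_i(v)\cap S_j(w)\neq \emptyset$, $S_i(v)\not\subseteq S_{k,j}(w)$ for all $k$ with $i \le k < j$, and one of the following conditions holds: (a) $j<D$; (b) $j=D$, and ($v_{[i,D-1]}\ne v_{[i+1,D]}$ or $S_{i-1,j}(w)=\emptyset$). (3) The intersection $S_{i}^\star(v) \cap S_{i-1}^{\star}(w)$ is empty if and only if $G=B(d,D)$ and $v_i=v_{i+1}=\cdots=v_D=w_D$. Furthermore, if $S_{i}^\star(v)\cap S_{i-1}^{\star}(w)=\emptyset$, then $S_{i}^\star(v)\cap S_{i}^{\star}(w)\ne\emptyset$. (4) The intersection $S_{i}^\star(v) \cap S_{j}^{\star}(w)$ is empty for all integers $j$, $i\le j\le D$, if and only if $G=B(d,D)$ and $v_i=v_{i+1}=\cdots=v_D\ne w_D$.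
   Context: Let $d\ge 2$ and $D\ge 1$ be integers. The De Bruijn digraph $B(d,D)$ has as vertices all words $v=v_1v_2\cdots v_D$ over an alphabet $A$ with $|A|=d$; $v$ is adjacent to the $d$ vertices $v_2\cdots v_D v_{D+1}$, $v_{D+1}\in A$ (loops occur). The Kautz digraph $K(d,D)$ has as vertices all words $v=v_1v_2\cdots v_D$ over an alphabet $A$ with $|A|=d+1$ such that $v_k\ne v_{k+1}$ for $1\le k<D$; $v$ is adjacent to the $d$ vertices $v_2\cdots v_Dv_{D+1}$ with $v_{D+1}\in A$, $v_{D+1}\ne v_D$. Both are $d$-regular of diameter $D$. For $v=v_1\cdots v_D$, $v_{[a,b]}$ denotes the subword $v_av_{a+1}\cdots v_b$. For $v\in V$ and $i\ge 0$, $S_i(v)$ is the set of vertices $u$ for which there is a walk of length exactly $i$ from $v$ to $u$ (so $S_1(v)$ is the set of vertices adjacent from $v$), and $S_i^\star(v)$ is the set of vertices at (directed) distance exactly $i$ from $v$. For integers $0\le k\le i\le D$: $S_{k,i}(v)=S_k(v)$ if $S_k(v)\subseteq S_i(v)$ and, for all $j$ with $k<j<i$ such that $S_j(v)\subseteq S_i(v)$, we have $S_k(v)\not\subseteq S_j(v)$; otherwise $S_{k,i}(v)=\emptyset$. *)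

theory Defs
  imports "Graph_Theory.Pair_Digraph" "Graph_Theory.Shortest_Path"
begin

text \<open>Words are lists; their positions are counted from 1, as in \<open>v = v\<^sub>1 v\<^sub>2 \<dots> v\<^sub>D\<close>.\<close>

definition letter :: "'a list \<Rightarrow> nat \<Rightarrow> 'a" where
  "letter v k = v ! (k - 1)"

definition subword :: "'a list \<Rightarrow> nat \<Rightarrow> nat \<Rightarrow> 'a list" where
  "subword v a b = drop (a - 1) (take b v)"

lemma length_subword:
  assumes "1 \<le> a" "a \<le> b" "b \<le> length v"
  shows "length (subword v a b) = b - a + 1"
  using assms by (auto simp: subword_def)

lemma letter_subword:
  assumes "1 \<le> a" "1 \<le> k" "a + k - 1 \<le> b" "b \<le> length v"
  shows "letter (subword v a b) k = letter v (a + k - 1)"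
proof -
  have "a - 1 + (k - 1) = a + k - 1 - 1" using assms by simp
  then show ?thesis using assms by (simp add: letter_def subword_def)
qed

definition debruijn_words :: "'a set \<Rightarrow> nat \<Rightarrow> 'a list set" where
  "debruijn_words A D = {v. length v = D \<and> set v \<subseteq> A}"

definition debruijn :: "'a set \<Rightarrow> nat \<Rightarrow> ('a list, 'a list \<times> 'a list) pre_digraph" where
  "debruijn A D = with_proj
     \<lparr> pverts = debruijn_words A D,
       parcs = {(v, tl v @ [a]) | v a. v \<in> debruijn_words A D \<and> a \<in> A} \<rparr>"

definition kautz_words :: "'a set \<Rightarrow> nat \<Rightarrow> 'a list set" where
  "kautz_words A D = {v. length v = D \<and> set v \<subseteq> A \<and> distinct_adj v}"

definition kautz :: "'a set \<Rightarrow> nat \<Rightarrow> ('a list, 'a list \<times> 'a list) pre_digraph" where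
  "kautz A D = with_proj
     \<lparr> pverts = kautz_words A D,
       parcs = {(v, tl v @ [a]) | v a. v \<in> kautz_words A D \<and> a \<in> A \<and> a \<noteq> last v} \<rparr>"

definition is_debruijn :: "nat \<Rightarrow> nat \<Rightarrow> ('a list, 'a list \<times> 'a list) pre_digraph \<Rightarrow> bool" where
  "is_debruijn d D G \<longleftrightarrow> (\<exists>A. finite A \<and> card A = d \<and> G = debruijn A D)"

definition is_kautz :: "nat \<Rightarrow> nat \<Rightarrow> ('a list, 'a list \<times> 'a list) pre_digraph \<Rightarrow> bool" where
  "is_kautz d D G \<longleftrightarrow> (\<exists>A. finite A \<and> card A = d + 1 \<and> G = kautz A D)"

text \<open>In the order of definition: \<open>S\<^sub>i(v)\<close>, \<open>S\<^sub>i\<^sup>\<star>(v)\<close> and \<open>S\<^sub>k\<^sub>,\<^sub>i(v)\<close>.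
  The distance is the minimal cost of a walk all of whose arcs have weight 1.\<close>

definition walk_sphere :: "('v, 'e) pre_digraph \<Rightarrow> nat \<Rightarrow> 'v \<Rightarrow> 'v set" where
  "walk_sphere G i v = {u. \<exists>p. pre_digraph.awalk G v p u \<and> length p = i}"

definition dist_sphere :: "('v, 'e) pre_digraph \<Rightarrow> nat \<Rightarrow> 'v \<Rightarrow> 'v set" where
  "dist_sphere G i v = {u \<in> verts G. wf_digraph.\<mu> G (\<lambda>_. 1) v u = ereal (real i)}"

definition walk_sphere2 :: "('v, 'e) pre_digraph \<Rightarrow> nat \<Rightarrow> nat \<Rightarrow> 'v \<Rightarrow> 'v set" where
  "walk_sphere2 G k i v =
     (if walk_sphere G k v \<subseteq> walk_sphere G i v \<and>
         (\<forall>j. k < j \<and> j < i \<and> walk_sphere G j v \<subseteq> walk_sphere G i v \<longrightarrow>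
              \<not> walk_sphere G k v \<subseteq> walk_sphere G j v)
      then walk_sphere G k v else {})"

text \<open>The constant \<open>wf_digraph.\<mu>\<close> is meaningful only for well-formed digraphs, which the digraphs
  considered here are.\<close>

lemma wf_debruijn:
  assumes "D \<ge> 1"
  shows "wf_digraph (debruijn A D)"
proof
  fix e assume "e \<in> arcs (debruijn A D)"
  then obtain v a where e: "e = (v, tl v @ [a])" and v: "v \<in> debruijn_words A D" and a: "a \<in> A"
    by (auto simp: debruijn_def)
  show "tail (debruijn A D) e \<in> verts (debruijn A D)"
    using e v by (simp add: debruijn_def)
  show "head (debruijn A D) e \<in> verts (debruijn A D)"
    using e v a assms by (cases v) (auto simp: debruijn_def debruijn_words_def)
qed

lemma wf_kautz:
  assumes "D \<ge> 1"
  shows "wf_digraph (kautz A D)"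
proof
  fix e assume "e \<in> arcs (kautz A D)"
  then obtain v a where e: "e = (v, tl v @ [a])" and v: "v \<in> kautz_words A D"
    and a: "a \<in> A" "a \<noteq> last v"
    by (auto simp: kautz_def)
  show "tail (kautz A D) e \<in> verts (kautz A D)"
    using e v by (simp add: kautz_def)
  show "head (kautz A D) e \<in> verts (kautz A D)"
    using e v a assms
    by (cases v) (auto simp: kautz_def kautz_words_def distinct_adj_append_iff distinct_adj_Cons)
qed

lemma dist_sphere_iff:
  assumes "wf_digraph G"
  shows "u \<in> dist_sphere G i v \<longleftrightarrow>
    u \<in> walk_sphere G i v \<and> (\<forall>j<i. u \<notin> walk_sphere G j v)"
proof -
  interpret wf_digraph G by fact
  have cost: "awalk_cost (\<lambda>_. 1) p = real (length p)" for p
    by (induction p) auto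
  let ?L = "{n. u \<in> walk_sphere G n v}"
  have mu: "\<mu> (\<lambda>_. 1) v u = (INF n\<in>?L. ereal (real n))"
    unfolding \<mu>_def cost walk_sphere_def
    by (rule INF_eq) auto
  show ?thesis
  proof (cases "?L = {}")
    case True
    then show ?thesis using mu by (auto simp: dist_sphere_def top_ereal_def)
  next
    case False
    define m where "m = (LEAST n. n \<in> ?L)"
    have m: "m \<in> ?L" unfolding m_def using False by (meson LeastI equals0I)
    have le: "m \<le> n" if "n \<in> ?L" for n unfolding m_def using that by (rule Least_le)
    have "(INF n\<in>?L. ereal (real n)) = ereal (real m)"
      using m le by (intro antisym INF_lower INF_greatest) auto
    moreover have "u \<in> verts G" using m by (auto simp: walk_sphere_def)
    ultimately have "u \<in> dist_sphere G i v \<longleftrightarrow> m = i"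
      by (auto simp: dist_sphere_def mu)
    also have "\<dots> \<longleftrightarrow> u \<in> walk_sphere G i v \<and> (\<forall>j<i. u \<notin> walk_sphere G j v)"
      using m le by (metis (mono_tags, lifting) linorder_not_less mem_Collect_eq nat_less_le)
    finally show ?thesis .
  qed
qed

end

theory Submission
  imports Defs
begin

text \<open>
  Both digraphs are instances of one construction: the vertices are the words of length \<open>D\<close> whose
  consecutive letters are related by some \<open>R\<close>, and in the case \<open>d = 2\<close> each letter has exactly two
  \<open>R\<close>-successors. The words \<open>x\<close> in \<open>S\<^sub>k(u)\<close>, \<open>k < D\<close>, are those that start with \<open>u\<close> without its
  first \<open>k\<close> letters (lemma \<open>mem_S_iff\<close>). Hence \<open>S\<^sub>k(u)\<close> has \<open>2\<^sup>k\<close> elements, and for \<open>k \<le> j\<close> it is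
  either contained in \<open>S\<^sub>j(u')\<close> or disjoint from it.

  Let \<open>w\<close> and \<open>w'\<close> be the two out-neighbours of \<open>v\<close>, so that \<open>S\<^sub>i(v)\<close> is the disjoint union of
  \<open>S\<^sub>i\<^sub>-\<^sub>1(w)\<close> and \<open>S\<^sub>i\<^sub>-\<^sub>1(w')\<close>. For an out-neighbour \<open>u\<close> let \<open>T(u)\<close> be what remains of \<open>S\<^sub>i\<^sub>-\<^sub>1(u)\<close>
  after all \<open>S\<^sub>k(v)\<close>, \<open>k < i\<close>, have been removed. As \<open>S\<^sub>k(w) \<subseteq> S\<^sub>k\<^sub>+\<^sub>1(v)\<close>, the elements of
  \<open>S\<^sub>i\<^sup>\<star>(v)\<close> at distance \<open>i - 1\<close> from \<open>w\<close> are exactly those of \<open>T(w)\<close>, and the elements of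
  \<open>S\<^sub>i\<^sup>\<star>(v)\<close> at distance at least \<open>i\<close> from \<open>w\<close> are exactly those of \<open>T(w')\<close>.

  Everything now rests on deciding when \<open>T(u)\<close> is empty (lemma \<open>fresh_nonempty_iff\<close>). The sets
  \<open>S\<^sub>k(v)\<close> with \<open>k < i - 1\<close> together have at most \<open>2\<^sup>i\<^sup>-\<^sup>1 - 1\<close> elements, too few to exhaust
  \<open>S\<^sub>i\<^sub>-\<^sub>1(u)\<close>, and \<open>S\<^sub>i\<^sub>-\<^sub>1(v)\<close> is equal to it or disjoint from it. So \<open>T(u)\<close> is empty iff
  \<open>S\<^sub>i\<^sub>-\<^sub>1(u) = S\<^sub>i\<^sub>-\<^sub>1(v)\<close>, which means that \<open>v\<^sub>i, \<dots>, v\<^sub>D\<close> are all equal to the last letter of \<open>u\<close>.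

  With \<open>u = w\<close> this is part (3), and with \<open>u = w'\<close>, since every vertex is within distance \<open>D\<close> of
  \<open>w\<close>, it is part (4). For parts (1) and (2) one intersects \<open>T(w')\<close> with \<open>S\<^sub>j(w)\<close> and removes the
  \<open>S\<^sub>k(w)\<close>, \<open>i \<le> k < j\<close>; for \<open>i < D\<close> each of these sets contains all of \<open>S\<^sub>i(v)\<close> or none of it. The
  alternative (a)/(b) of part (2) is a rewording of \<open>T(w') \<noteq> \<emptyset>\<close>, valid when \<open>S\<^sub>i(v)\<close> and \<open>S\<^sub>j(w)\<close> meet
  (lemma \<open>constant_tail_iff\<close>).
\<close>

section \<open>Constant words\<close>

lemma tl_snoc_eq_iff:
  assumes "xs \<noteq> []"
  shows "tl xs @ [c] = xs \<longleftrightarrow> (\<forall>x\<in>set xs. x = c)"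
  using assms
proof (induction xs)
  case (Cons a xs)
  then show ?case by (cases xs) auto
qed simp

lemma butlast_eq_tl_iff:
  assumes "xs \<noteq> []"
  shows "butlast xs = tl xs \<longleftrightarrow> xs = tl xs @ [last xs]"
  using assms by (metis append_butlast_last_id append_same_eq)

section \<open>A common description of both digraphs\<close>

definition shift_words :: "('a \<Rightarrow> 'a \<Rightarrow> bool) \<Rightarrow> 'a set \<Rightarrow> nat \<Rightarrow> 'a list set" where
  "shift_words R A D = {v. length v = D \<and> set v \<subseteq> A \<and> successively R v}"

definition shift_digraph ::
    "('a \<Rightarrow> 'a \<Rightarrow> bool) \<Rightarrow> 'a set \<Rightarrow> nat \<Rightarrow> ('a list, 'a list \<times> 'a list) pre_digraph" where
  "shift_digraph R A D = with_proj
     \<lparr> pverts = shift_words R A D,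
       parcs = {(v, tl v @ [a]) | v a. v \<in> shift_words R A D \<and> a \<in> A \<and> R (last v) a} \<rparr>"

lemma successively_True: "successively (\<lambda>_ _. True) xs"
  by (auto simp: successively_conv_nth)

lemma debruijn_eq_shift: "debruijn A D = shift_digraph (\<lambda>_ _. True) A D"
  by (simp add: debruijn_def debruijn_words_def shift_digraph_def shift_words_def successively_True)

lemma kautz_eq_shift: "kautz A D = shift_digraph (\<noteq>) A D"
  unfolding kautz_def kautz_words_def shift_digraph_def shift_words_def distinct_adj_def
  by (simp add: eq_commute)

text \<open>With \<open>two_followers\<close>, the condition \<open>follows_if_neq\<close> leaves, for nonempty \<open>A\<close>, just the two
  families at \<open>d = 2\<close>: two letters that may all be repeated, or three letters none of which may.
  The second condition is what bounds the diameter by \<open>D\<close>.\<close>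
locale binary_shift =
  fixes R :: "'a \<Rightarrow> 'a \<Rightarrow> bool" and A :: "'a set" and D :: nat
  assumes D_pos: "D \<ge> 1"
    and two_followers: "a \<in> A \<Longrightarrow> card {b \<in> A. R a b} = 2"
    and follows_if_neq: "a \<in> A \<Longrightarrow> b \<in> A \<Longrightarrow> a \<noteq> b \<Longrightarrow> R a b"
begin

abbreviation "W \<equiv> shift_words R A D"
abbreviation "G \<equiv> shift_digraph R A D"
abbreviation "S \<equiv> walk_sphere G"
abbreviation "Sd \<equiv> dist_sphere G"

lemma verts_G: "verts G = W"
  by (simp add: shift_digraph_def)

lemma arcs_G: "arcs G = {(v, tl v @ [a]) | v a. v \<in> W \<and> a \<in> A \<and> R (last v) a}"
  by (simp add: shift_digraph_def)

lemma length_W [simp]: "v \<in> W \<Longrightarrow> length v = D"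
  and set_W: "v \<in> W \<Longrightarrow> set v \<subseteq> A"
  and successively_W: "v \<in> W \<Longrightarrow> successively R v"
  by (simp_all add: shift_words_def)

lemma W_nonempty: "v \<in> W \<Longrightarrow> v \<noteq> []"
  using D_pos length_W by fastforce

lemma last_in_A: "v \<in> W \<Longrightarrow> last v \<in> A"
  using W_nonempty set_W last_in_set by blast

lemma nth_in_A: "v \<in> W \<Longrightarrow> n < D \<Longrightarrow> v ! n \<in> A"
  using set_W[of v] nth_mem[of n v] by auto

lemma shift_in_W:
  assumes "v \<in> W" "a \<in> A" "R (last v) a"
  shows "tl v @ [a] \<in> W"
  using assms W_nonempty[OF assms(1)] unfolding shift_words_def
  by (cases v) (auto simp: successively_append_iff successively_Cons split: if_splits)

lemma wf_G: "wf_digraph G"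
proof
  fix e assume e: "e \<in> arcs G"
  then obtain v a where va: "e = (v, tl v @ [a])" "v \<in> W" "a \<in> A" "R (last v) a"
    unfolding arcs_G by blast
  show "tail G e \<in> verts G"
    using va(1,2) by (simp add: shift_digraph_def)
  show "head G e \<in> verts G"
    using shift_in_W[OF va(2-)] va(1) by (simp add: shift_digraph_def)
qed

lemma S_0: "v \<in> W \<Longrightarrow> S 0 v = {v}"
  by (auto simp: walk_sphere_def pre_digraph.awalk_def pre_digraph.cas.simps verts_G)

lemma S_Suc:
  assumes "v \<in> W"
  shows "S (Suc k) v = (\<Union>a\<in>{a \<in> A. R (last v) a}. S k (tl v @ [a]))"
proof -
  interpret wf_digraph G by (rule wf_G)
  have ht: "tail G e = fst e" "head G e = snd e" for e
    by (simp_all add: shift_digraph_def)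
  have "x \<in> S (Suc k) v \<longleftrightarrow> (\<exists>e p. awalk v (e # p) x \<and> length p = k)" for x
    by (auto simp: walk_sphere_def length_Suc_conv)
  moreover have "awalk v (e # p) x \<longleftrightarrow>
      (\<exists>a\<in>A. R (last v) a \<and> e = (v, tl v @ [a]) \<and> awalk (tl v @ [a]) p x)" for e p x
    using assms by (auto simp: awalk_Cons_iff arcs_G ht)
  ultimately show ?thesis by (auto simp: walk_sphere_def)
qed

lemma Sd_iff: "x \<in> Sd i v \<longleftrightarrow> x \<in> S i v \<and> (\<forall>j<i. x \<notin> S j v)"
  by (rule dist_sphere_iff[OF wf_G])

section \<open>Walk spheres as sets of words with a common prefix\<close>

text \<open>A walk of length \<open>k\<close> deletes the first \<open>k\<close> letters and appends \<open>k\<close> new ones, which are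
  subject only to \<open>R\<close>. For \<open>k < D\<close> the old last letter survives inside the word, so that \<open>R\<close> holds
  at the junction because the target is a word of the digraph; for \<open>k = D\<close> it has disappeared and
  the condition must be stated.\<close>
lemma mem_S_iff:
  assumes "v \<in> W" "k \<le> D"
  shows "x \<in> S k v \<longleftrightarrow>
    x \<in> W \<and> take (D - k) x = drop k v \<and> (k = D \<longrightarrow> R (last v) (hd x))"
  using assms
proof (induction k arbitrary: v)
  case 0
  then show ?case using D_pos by (auto simp: S_0)
next
  case (Suc k)
  define n where "n = D - Suc k"
  have n: "D - k = Suc n" "n < D" using Suc.prems by (auto simp: n_def)
  have v: "v \<in> W" by (rule Suc.prems)
  have "x \<in> S (Suc k) v \<longleftrightarrow> (\<exists>a\<in>A. R (last v) a \<and> x \<in> S k (tl v @ [a]))"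
    by (auto simp: S_Suc[OF v])
  also have "\<dots> \<longleftrightarrow> (\<exists>a\<in>A. R (last v) a \<and> x \<in> W \<and> take (Suc n) x = drop (Suc k) v @ [a])"
  proof (intro bex_cong refl conj_cong)
    fix a assume a: "a \<in> A" "R (last v) a"
    have "drop k (tl v @ [a]) = drop (Suc k) v @ [a]"
      using Suc.prems by (simp add: drop_Suc)
    then show "x \<in> S k (tl v @ [a]) \<longleftrightarrow> x \<in> W \<and> take (Suc n) x = drop (Suc k) v @ [a]"
      using Suc.IH[OF shift_in_W[OF v a]] Suc.prems n by simp
  qed
  also have "\<dots> \<longleftrightarrow> x \<in> W \<and> take n x = drop (Suc k) v \<and> R (last v) (x ! n)"
    using n nth_in_A[of x n] by (auto simp: take_Suc_conv_app_nth)
  also have "\<dots> \<longleftrightarrow> x \<in> W \<and> take n x = drop (Suc k) v \<and> (Suc k = D \<longrightarrow> R (last v) (hd x))"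
  proof (intro conj_cong refl)
    assume x: "x \<in> W" and pre: "take n x = drop (Suc k) v"
    show "R (last v) (x ! n) \<longleftrightarrow> (Suc k = D \<longrightarrow> R (last v) (hd x))"
    proof (cases "Suc k = D")
      case True
      then show ?thesis using W_nonempty[OF x] by (simp add: n_def hd_conv_nth)
    next
      case False
      then obtain l where l: "n = Suc l" using Suc.prems by (cases n) (auto simp: n_def)
      have "last v = last (take n x)"
        using False Suc.prems unfolding pre by (simp add: last_drop)
      also have "\<dots> = x ! l"
        using x n l by (simp add: take_Suc_conv_app_nth)
      finally have "R (last v) (x ! n)"
        using successively_W[OF x] x n l by (auto simp: successively_conv_nth)
      then show ?thesis using False by simp
    qed
  qed
  finally show ?case by (simp add: n_def)
qed

lemma S_subset_W: "v \<in> W \<Longrightarrow> k \<le> D \<Longrightarrow> S k v \<subseteq> W"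
  by (auto simp: mem_S_iff)

lemma nth_of_mem_S:
  assumes "v \<in> W" "x \<in> S k v" "k + n < D"
  shows "x ! n = v ! (k + n)"
proof -
  have "take (D - k) x ! n = drop k v ! n" using assms by (simp add: mem_S_iff)
  then show ?thesis using assms by simp
qed

lemma last_via_nth: "v \<in> W \<Longrightarrow> last v = v ! (D - 1)"
  using W_nonempty[of v] by (auto simp: last_conv_nth)

text \<open>Both sets consist of the words with a prescribed prefix, of the same length.\<close>
lemma S_eq_or_disjoint:
  assumes "u \<in> W" "v \<in> W" "k < D"
  shows "if drop k u = drop k v then S k u = S k v else S k u \<inter> S k v = {}"
proof -
  have "x \<in> S k u \<longleftrightarrow> x \<in> W \<and> take (D - k) x = drop k u"
    "x \<in> S k v \<longleftrightarrow> x \<in> W \<and> take (D - k) x = drop k v" for x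
    using assms by (auto simp: mem_S_iff)
  then show ?thesis by auto
qed

text \<open>Membership in \<open>S\<^sub>j(v)\<close> depends only on the first \<open>D - j\<close> letters, or on the first letter if
  \<open>j = D\<close>, and all elements of \<open>S\<^sub>k(u)\<close> agree on these.\<close>
lemma S_subset_if_meets:
  assumes "u \<in> W" "v \<in> W" "k \<le> j" "k < D" "j \<le> D" "S k u \<inter> S j v \<noteq> {}"
  shows "S k u \<subseteq> S j v"
proof
  obtain x where x: "x \<in> S k u" "x \<in> S j v" using assms(6) by blast
  fix y assume y: "y \<in> S k u"
  have xy: "take (D - k) y = take (D - k) x" "x \<in> W" "y \<in> W"
    using x y assms by (auto simp: mem_S_iff)
  have "take (D - j) y = take (D - j) (take (D - k) y)" using assms by simp
  also have "\<dots> = take (D - j) (take (D - k) x)" by (simp only: xy)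
  also have "\<dots> = take (D - j) x" using assms by simp
  finally have 1: "take (D - j) y = take (D - j) x" .
  have "hd (take (D - k) y) = hd (take (D - k) x)" by (simp only: xy)
  then have "hd y = hd x" using assms by (simp add: hd_take)
  with 1 show "y \<in> S j v" using x xy assms by (simp add: mem_S_iff)
qed

lemma followers:
  assumes "a \<in> A"
  obtains b c where "b \<noteq> c" "{b \<in> A. R a b} = {b, c}"
  using two_followers[OF assms] by (auto simp: card_2_iff)

lemma shifts_disjoint:
  assumes "tl v @ [b] \<in> W" "tl v @ [c] \<in> W" "b \<noteq> c" "k < D"
  shows "S k (tl v @ [b]) \<inter> S k (tl v @ [c]) = {}"
proof -
  have "k \<le> length (tl v)" using length_W[OF assms(1)] assms(4) by simp
  then have "drop k (tl v @ [b]) \<noteq> drop k (tl v @ [c])" using assms(3) by simp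
  then show ?thesis using S_eq_or_disjoint[OF assms(1,2,4)] by simp
qed

lemma card_S:
  assumes "v \<in> W" "k \<le> D"
  shows "finite (S k v) \<and> card (S k v) = 2 ^ k"
  using assms
proof (induction k arbitrary: v)
  case 0
  then show ?case by (simp add: S_0)
next
  case (Suc k)
  obtain b c where bc: "b \<noteq> c" "{b \<in> A. R (last v) b} = {b, c}"
    using followers last_in_A[OF Suc.prems(1)] by metis
  have "b \<in> {b \<in> A. R (last v) b}" "c \<in> {b \<in> A. R (last v) b}" using bc(2) by auto
  then have W: "tl v @ [b] \<in> W" "tl v @ [c] \<in> W"
    using shift_in_W[OF Suc.prems(1)] by auto
  have "S (Suc k) v = S k (tl v @ [b]) \<union> S k (tl v @ [c])"
    by (simp add: S_Suc[OF Suc.prems(1)] bc)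
  then show ?case
    using Suc.IH[OF W(1)] Suc.IH[OF W(2)] shifts_disjoint[OF W bc(1)] Suc.prems
    by (simp add: card_Un_disjoint)
qed

lemma S_nonempty: "v \<in> W \<Longrightarrow> k \<le> D \<Longrightarrow> S k v \<noteq> {}"
  using card_S[of v k] by auto

section \<open>The counting argument\<close>

text \<open>This is the set \<open>T(u)\<close> of the introduction, with \<open>m = i - 1\<close>.\<close>
definition fresh :: "'a list \<Rightarrow> nat \<Rightarrow> 'a list \<Rightarrow> 'a list set" where
  "fresh v m u = S m u - (\<Union>k\<le>m. S k v)"

text \<open>The spheres \<open>S\<^sub>k(v)\<close> with \<open>k < m\<close> cover at most \<open>2\<^sup>m - 1\<close> of the \<open>2\<^sup>m\<close> elements of \<open>S\<^sub>m(u)\<close>, so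
  only \<open>S\<^sub>m(v)\<close> can exhaust it, and then the two are equal.\<close>
lemma fresh_nonempty_iff:
  assumes "u \<in> W" "v \<in> W" "m < D"
  shows "fresh v m u \<noteq> {} \<longleftrightarrow> drop m u \<noteq> drop m v"
proof
  assume "drop m u \<noteq> drop m v"
  then have disj: "S m u \<inter> S m v = {}" using S_eq_or_disjoint[OF assms] by simp
  have fin: "finite (S k v)" "card (S k v) = 2 ^ k" if "k < m" for k
    using card_S[OF assms(2), of k] that assms(3) by auto
  have "card (\<Union>k<m. S k v) \<le> (\<Sum>k<m. card (S k v))"
    by (rule card_UN_le) simp
  also have "\<dots> = (\<Sum>k<m. 2 ^ k)" using fin by simp
  also have "\<dots> < (2 ^ m :: nat)" by (simp add: lessThan_atLeast0 sum_power2)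
  also have "\<dots> = card (S m u)" using card_S[OF assms(1)] assms(3) by simp
  finally have "card (\<Union>k<m. S k v) < card (S m u)" .
  moreover have "finite (\<Union>k<m. S k v)" using fin by auto
  ultimately obtain x where x: "x \<in> S m u" "x \<notin> (\<Union>k<m. S k v)"
    using card_mono[of "\<Union>k<m. S k v" "S m u"] by (meson linorder_not_le subsetI)
  then have "x \<notin> S k v" if "k \<le> m" for k
    using that disj by (cases "k = m") auto
  then show "fresh v m u \<noteq> {}"
    using x unfolding fresh_def by blast
next
  assume "fresh v m u \<noteq> {}"
  then show "drop m u \<noteq> drop m v"
    using S_eq_or_disjoint[OF assms] by (auto simp: fresh_def)
qed

text \<open>If \<open>D\<close> steps do not lead from \<open>u\<close> to \<open>x\<close>, then the first letter of \<open>x\<close> may not follow the last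
  letter of \<open>u\<close>; so the two are equal, and \<open>D - 1\<close> steps suffice.\<close>
lemma reachable_within_D:
  assumes "u \<in> W" "x \<in> W"
  shows "\<exists>k\<le>D. x \<in> S k u"
proof (cases "hd x = last u")
  case True
  have "take 1 x = [last u]" using True W_nonempty[OF assms(2)] by (cases x) auto
  moreover have "drop (D - 1) u = [last u]"
    using W_nonempty[OF assms(1)] length_W[OF assms(1)] by (cases u rule: rev_cases) auto
  moreover have "D - 1 \<noteq> D" using D_pos by simp
  ultimately have "x \<in> S (D - 1) u" using assms D_pos by (simp add: mem_S_iff)
  then show ?thesis using D_pos by (intro exI[of _ "D - 1"]) simp
next
  case False
  have "hd x \<in> A" using nth_in_A[OF assms(2), of 0] D_pos W_nonempty[OF assms(2)] by (simp add: hd_conv_nth)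
  then have "x \<in> S D u"
    using False assms follows_if_neq[of "last u" "hd x"] last_in_A[OF assms(1)] by (simp add: mem_S_iff)
  then show ?thesis by blast
qed

lemma dist_exists:
  assumes "u \<in> W" "x \<in> W"
  shows "\<exists>j\<le>D. x \<in> Sd j u"
proof -
  define j where "j = (LEAST k. x \<in> S k u)"
  obtain k where k: "k \<le> D" "x \<in> S k u" using reachable_within_D[OF assms] by blast
  have "x \<in> S j u" unfolding j_def using k(2) by (rule LeastI)
  moreover have "j \<le> D" unfolding j_def using k Least_le[of "\<lambda>k. x \<in> S k u"] by fastforce
  moreover have "\<forall>l<j. x \<notin> S l u" unfolding j_def using not_less_Least by blast
  ultimately show ?thesis by (auto simp: Sd_iff)
qed

end

section \<open>Distance spheres of a vertex and of an out-neighbour\<close>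

locale binary_shift_arc = binary_shift +
  fixes v w w' :: "'a list" and c b :: 'a
  assumes v: "v \<in> W"
    and w_def: "w = tl v @ [c]"
    and w'_def: "w' = tl v @ [b]"
    and c_neq_b: "c \<noteq> b"
    and followers_last: "{a \<in> A. R (last v) a} = {c, b}"
begin

lemma cb: "c \<in> A" "b \<in> A" "R (last v) c" "R (last v) b"
  using followers_last by blast+

lemma w: "w \<in> W" and w': "w' \<in> W"
  using shift_in_W[OF v] cb by (auto simp: w_def w'_def)

lemma last_w [simp]: "last w = c" and last_w' [simp]: "last w' = b"
  by (simp_all add: w_def w'_def)

lemma S_Suc_v: "S (Suc m) v = S m w \<union> S m w'"
  by (simp add: S_Suc[OF v] followers_last w_def w'_def)

lemma disjoint_w_w': "m < D \<Longrightarrow> S m w \<inter> S m w' = {}"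
  using shifts_disjoint[of v c b m] w w' c_neq_b by (simp add: w_def w'_def)

lemma drop_shift: "m < D \<Longrightarrow> drop m (tl v @ [a]) = tl (drop m v) @ [a]"
  using v by (simp add: tl_drop)

text \<open>A word that agrees with its own shift is constant; this is where the condition
  \<open>v\<^sub>i = \<dots> = v\<^sub>D\<close> comes from.\<close>
lemma drop_eq_drop_shift_iff:
  assumes "m < D"
  shows "drop m (tl v @ [a]) = drop m v \<longleftrightarrow> (\<forall>x\<in>set (drop m v). x = a)"
  using assms v tl_snoc_eq_iff[of "drop m v" a] by (simp add: drop_shift tl_drop)

lemma set_drop_letters:
  "(\<forall>x\<in>set (drop m v). x = a) \<longleftrightarrow> (\<forall>k\<in>{Suc m..D}. letter v k = a)"
proof
  assume h: "\<forall>x\<in>set (drop m v). x = a"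
  show "\<forall>k\<in>{Suc m..D}. letter v k = a"
  proof
    fix k assume "k \<in> {Suc m..D}"
    then have "drop m v ! (k - Suc m) = v ! (k - 1)" "drop m v ! (k - Suc m) \<in> set (drop m v)"
      using v nth_mem[of "k - Suc m" "drop m v"] by auto
    then show "letter v k = a" using h by (auto simp: letter_def)
  qed
next
  assume h: "\<forall>k\<in>{Suc m..D}. letter v k = a"
  show "\<forall>x\<in>set (drop m v). x = a"
  proof
    fix x assume "x \<in> set (drop m v)"
    then obtain n where "n < D - m" "x = v ! (m + n)" using v by (auto simp: in_set_conv_nth)
    then show "x = a" using bspec[OF h, of "Suc (m + n)"] by (simp add: letter_def)
  qed
qed

text \<open>No \<open>S\<^sub>l(w)\<close> with \<open>l < m\<close> has to be removed separately, because it lies in \<open>S\<^sub>l\<^sub>+\<^sub>1(v)\<close>.\<close>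
lemma Sd_inter_near:
  assumes "m < D"
  shows "Sd (Suc m) v \<inter> Sd m w = fresh v m w"
proof -
  have "x \<notin> S l w" if "\<forall>k\<le>m. x \<notin> S k v" "l < m" for x l
    using S_Suc_v[of l] that(1)[rule_format, of "Suc l"] that(2) by auto
  then show ?thesis
    by (auto simp: Sd_iff fresh_def S_Suc_v less_Suc_eq_le)
qed

text \<open>Being far from \<open>w\<close> excludes \<open>S\<^sub>m(w)\<close>, the one half of \<open>S\<^sub>m\<^sub>+\<^sub>1(v)\<close>; conversely the other half
  \<open>S\<^sub>m(w')\<close> avoids it, and the smaller spheres of \<open>w\<close> lie in spheres \<open>S\<^sub>l(v)\<close> with \<open>l \<le> m\<close>.\<close>
lemma Sd_far:
  assumes "m < D"
  shows "{x \<in> Sd (Suc m) v. \<forall>k\<le>m. x \<notin> S k w} = fresh v m w'"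
proof (intro set_eqI iffI)
  fix x assume "x \<in> {x \<in> Sd (Suc m) v. \<forall>k\<le>m. x \<notin> S k w}"
  then show "x \<in> fresh v m w'"
    using S_Suc_v[of m] by (auto simp: Sd_iff fresh_def less_Suc_eq_le)
next
  fix x assume "x \<in> fresh v m w'"
  then have x: "x \<in> S m w'" by (simp add: fresh_def)
  have new: "x \<notin> S k v" if "k \<le> m" for k
    using \<open>x \<in> fresh v m w'\<close> that by (simp add: fresh_def)
  have "x \<notin> S k w" if "k \<le> m" for k
  proof (cases "k = m")
    case True
    then show ?thesis using x disjoint_w_w'[OF assms] by blast
  next
    case False
    then show ?thesis using new[of "Suc k"] that S_Suc_v[of k] by simp
  qed
  then show "x \<in> {x \<in> Sd (Suc m) v. \<forall>k\<le>m. x \<notin> S k w}"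
    using x new S_Suc_v[of m] by (simp add: Sd_iff less_Suc_eq_le)
qed

lemma Sd_inter_far:
  assumes "m < D" "Suc m \<le> j"
  shows "Sd (Suc m) v \<inter> Sd j w = {x \<in> fresh v m w' \<inter> S j w. \<forall>k. Suc m \<le> k \<and> k < j \<longrightarrow> x \<notin> S k w}"
proof -
  have split: "(\<forall>k<j. P k) \<longleftrightarrow> (\<forall>k\<le>m. P k) \<and> (\<forall>k. Suc m \<le> k \<and> k < j \<longrightarrow> P k)" for P
  proof (intro iffI conjI allI impI)
    fix k assume P: "(\<forall>k\<le>m. P k) \<and> (\<forall>k. Suc m \<le> k \<and> k < j \<longrightarrow> P k)" and "k < j"
    then show "P k" by (cases "k \<le> m") (simp_all add: not_le Suc_le_eq)
  qed (use assms(2) in simp_all)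
  show ?thesis
  proof (intro set_eqI)
    fix x
    show "x \<in> Sd (Suc m) v \<inter> Sd j w \<longleftrightarrow>
      x \<in> {x \<in> fresh v m w' \<inter> S j w. \<forall>k. Suc m \<le> k \<and> k < j \<longrightarrow> x \<notin> S k w}"
      unfolding Sd_far[OF assms(1), symmetric] Int_iff mem_Collect_eq
        Sd_iff[of x j w] split[of "\<lambda>k. x \<notin> S k w"]
      by argo
  qed
qed

lemma fresh_w_empty_iff:
  assumes "m < D"
  shows "fresh v m w = {} \<longleftrightarrow> (\<forall>k\<in>{Suc m..D}. letter v k = c)"
  using fresh_nonempty_iff[OF w v assms]
  unfolding w_def drop_eq_drop_shift_iff[OF assms] set_drop_letters by metis

lemma fresh_w'_empty_iff:
  assumes "m < D"
  shows "fresh v m w' = {} \<longleftrightarrow> (\<forall>k\<in>{Suc m..D}. letter v k = b)"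
  using fresh_nonempty_iff[OF w' v assms]
  unfolding w'_def drop_eq_drop_shift_iff[OF assms] set_drop_letters by metis

lemma letter_D: "letter v D = last v"
  using last_via_nth[OF v] by (simp add: letter_def)

section \<open>Criteria for intersecting distance spheres\<close>

text \<open>The words in \<open>S\<^sub>D\<^sub>-\<^sub>1(w')\<close> start with \<open>b\<close>, the last letter of \<open>w'\<close>, which may follow \<open>c\<close>, the last
  letter of \<open>w\<close>. So all of \<open>T(w')\<close> lies in \<open>S\<^sub>D(w)\<close>.\<close>
lemma dist_spheres_meet_at_diameter: "Sd D v \<inter> Sd D w \<noteq> {} \<longleftrightarrow> last v \<noteq> b"
proof -
  obtain m where m: "D = Suc m" using D_pos by (cases D) auto
  have "fresh v m w' \<subseteq> S D w"
  proof
    fix x assume "x \<in> fresh v m w'"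
    then have x: "x \<in> S m w'" by (simp add: fresh_def)
    then have "x \<in> W" using S_subset_W[OF w', of m] m by auto
    moreover have "x ! 0 = b"
      using nth_of_mem_S[OF w' x, of 0] last_via_nth[OF w'] m by simp
    ultimately have "x \<in> W" "hd x = b" using W_nonempty[of x] by (auto simp: hd_conv_nth)
    then show "x \<in> S D w"
      using w follows_if_neq[OF cb(1,2) c_neq_b] by (simp add: mem_S_iff[OF w])
  qed
  then have "Sd D v \<inter> Sd D w = fresh v m w'"
    using Sd_inter_far[of m D] m by auto
  then show ?thesis using fresh_w'_empty_iff[of m] letter_D m by simp
qed

text \<open>If \<open>T(w)\<close> is empty, then \<open>v\<close> ends in a run of \<open>c\<close>, and \<open>w\<close>, which appends another \<open>c\<close>, agrees
  with \<open>v\<close> from position \<open>m + 1\<close> on. Then \<open>S\<^sub>m\<^sub>+\<^sub>1(v) = S\<^sub>m\<^sub>+\<^sub>1(w)\<close>, and \<open>T(w')\<close>, which is nonempty since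
  \<open>v\<close> does not end in \<open>b\<close>, is the intersection.\<close>
lemma dist_spheres_meet_if_near_empty:
  assumes "m < D" "Sd (Suc m) v \<inter> Sd m w = {}"
  shows "Sd (Suc m) v \<inter> Sd (Suc m) w \<noteq> {}"
proof -
  have const: "\<forall>k\<in>{Suc m..D}. letter v k = c"
    using assms Sd_inter_near fresh_w_empty_iff by simp
  then have last: "last v = c" using assms letter_D by auto
  have "drop m w = drop m v"
    using const unfolding w_def drop_eq_drop_shift_iff[OF assms(1)] set_drop_letters .
  then have "drop (Suc m) v = drop (Suc m) w" by (metis drop_Suc tl_drop)
  then have "S (Suc m) v = S (Suc m) w"
    using assms(1) last by (intro set_eqI) (simp add: mem_S_iff[OF v] mem_S_iff[OF w])
  then have "fresh v m w' \<subseteq> S (Suc m) w" by (auto simp: fresh_def S_Suc_v)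
  then have "Sd (Suc m) v \<inter> Sd (Suc m) w = fresh v m w'"
    using Sd_inter_far[OF assms(1), of "Suc m"] by auto
  moreover have "letter v D \<noteq> b" using letter_D last c_neq_b by simp
  ultimately show ?thesis using fresh_w'_empty_iff[OF assms(1)] assms(1) by auto
qed

text \<open>The intersections for the various \<open>j\<close> partition \<open>T(w')\<close>.\<close>
lemma far_dist_spheres_empty_iff:
  assumes "m < D"
  shows "(\<forall>j. Suc m \<le> j \<and> j \<le> D \<longrightarrow> Sd (Suc m) v \<inter> Sd j w = {}) \<longleftrightarrow>
    (\<forall>k\<in>{Suc m..D}. letter v k = b)"
proof -
  have "\<exists>j. Suc m \<le> j \<and> j \<le> D \<and> x \<in> Sd (Suc m) v \<inter> Sd j w" if x: "x \<in> fresh v m w'" for x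
  proof -
    have far: "x \<in> Sd (Suc m) v" "\<forall>k\<le>m. x \<notin> S k w"
      using x Sd_far[OF assms] by auto
    have "x \<in> W" using x S_subset_W[OF w', of m] assms by (auto simp: fresh_def)
    then obtain j where j: "j \<le> D" "x \<in> Sd j w" using dist_exists[OF w] by blast
    then have "Suc m \<le> j" using far(2) by (auto simp: Sd_iff not_less_eq_eq)
    then show ?thesis using j far by blast
  qed
  moreover have "Sd (Suc m) v \<inter> Sd j w \<subseteq> fresh v m w'" if "Suc m \<le> j" for j
    using Sd_inter_far[OF assms that] by auto
  ultimately have "(\<forall>j. Suc m \<le> j \<and> j \<le> D \<longrightarrow> Sd (Suc m) v \<inter> Sd j w = {}) \<longleftrightarrow> fresh v m w' = {}"
    by blast
  then show ?thesis using fresh_w'_empty_iff[OF assms] by simp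
qed

text \<open>Among all \<open>S\<^sub>k(w)\<close>, \<open>i \<le> k < j\<close>, that contain \<open>S\<^sub>i(v)\<close>, the one with the greatest \<open>k\<close> is maximal
  in the sense of \<open>S\<^sub>k\<^sub>,\<^sub>j(w)\<close>.\<close>
lemma subset_walk_sphere2_iff:
  assumes "i \<le> j" "j \<le> D" "i < D" "S i v \<subseteq> S j w"
  shows "(\<exists>k. i \<le> k \<and> k < j \<and> S i v \<subseteq> walk_sphere2 G k j w) \<longleftrightarrow>
    (\<exists>k. i \<le> k \<and> k < j \<and> S i v \<subseteq> S k w)" (is "?L \<longleftrightarrow> ?M")
proof
  assume ?L
  then show ?M
    by (auto simp: walk_sphere2_def split: if_splits)
next
  let ?P = "\<lambda>k. i \<le> k \<and> k < j \<and> S i v \<subseteq> S k w"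
  assume ?M
  define k where "k = (GREATEST k. ?P k)"
  have k: "?P k" unfolding k_def
    using \<open>?M\<close> by (rule GreatestI_ex_nat[where b = j]) auto
  have k_max: "l \<le> k" if "?P l" for l unfolding k_def
    using that by (rule Greatest_le_nat[where b = j]) auto
  have "S k w \<inter> S j w \<noteq> {}" using k assms(3,4) S_nonempty[OF v, of i] by fastforce
  then have "S k w \<subseteq> S j w" using S_subset_if_meets[OF w w, of k j] k assms by simp
  moreover have "\<not> S k w \<subseteq> S l w" if "k < l" "l < j" for l
    using k_max[of l] k that by (meson order.trans less_imp_le not_less)
  ultimately show ?L using k by (auto simp: walk_sphere2_def)
qed

text \<open>The spheres \<open>S\<^sub>k(w)\<close> with \<open>m + 1 \<le> k \<le> j\<close> contain \<open>S\<^sub>m\<^sub>+\<^sub>1(v)\<close> or avoid it, so that the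
  intersection is all of \<open>T(w')\<close> or empty.\<close>
lemma dist_spheres_meet_iff_walk_spheres:
  assumes "Suc m \<le> j" "j \<le> D" "Suc m < D"
  shows "Sd (Suc m) v \<inter> Sd j w \<noteq> {} \<longleftrightarrow>
    S (Suc m) v \<inter> S j w \<noteq> {} \<and> (\<forall>k. Suc m \<le> k \<and> k < j \<longrightarrow> \<not> S (Suc m) v \<subseteq> S k w) \<and>
    \<not> (\<forall>k\<in>{Suc m..D}. letter v k = b)" (is "?L \<longleftrightarrow> ?M")
proof
  assume ?L
  then obtain x where "x \<in> Sd (Suc m) v" "x \<in> Sd j w" by blast
  then have "x \<in> S (Suc m) v" "x \<in> S j w" "\<And>k. k < j \<Longrightarrow> x \<notin> S k w"
    by (simp_all add: Sd_iff)
  moreover have "fresh v m w' \<noteq> {}" using \<open>?L\<close> Sd_inter_far[of m j] assms by auto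
  ultimately show ?M using fresh_w'_empty_iff[of m] assms(3) by auto
next
  assume M: ?M
  then have fresh: "fresh v m w' \<noteq> {}" using fresh_w'_empty_iff[of m] assms by simp
  have sub: "fresh v m w' \<subseteq> S (Suc m) v" by (auto simp: fresh_def S_Suc_v)
  have "S (Suc m) v \<subseteq> S j w" using M S_subset_if_meets[OF v w] assms by blast
  moreover have "S (Suc m) v \<inter> S k w = {}" if "Suc m \<le> k" "k < j" for k
    using M S_subset_if_meets[OF v w, of "Suc m" k] assms that by auto
  ultimately have "x \<in> S j w \<and> (\<forall>k. Suc m \<le> k \<and> k < j \<longrightarrow> x \<notin> S k w)"
    if "x \<in> fresh v m w'" for x
    using that sub by blast
  then have "Sd (Suc m) v \<inter> Sd j w = fresh v m w'"
    using Sd_inter_far[of m j] assms by auto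
  then show ?L using fresh by simp
qed

lemma subword_eq_iff:
  assumes "Suc m < D"
  shows "subword v (Suc m) (D - 1) = subword v (Suc m + 1) D \<longleftrightarrow>
    (\<forall>k\<in>{Suc m..D}. letter v k = last v)"
proof -
  have ne: "drop m v \<noteq> []" using assms v by simp
  have "subword v (Suc m) (D - 1) = butlast (drop m v)"
    using v by (simp add: subword_def butlast_conv_take drop_take)
  moreover have "subword v (Suc m + 1) D = tl (drop m v)"
    using v by (simp add: subword_def drop_Suc tl_drop)
  moreover have "last (drop m v) = last v" using assms v by (simp add: last_drop)
  ultimately show ?thesis
    using butlast_eq_tl_iff[OF ne] tl_snoc_eq_iff[OF ne, of "last v"] set_drop_letters[of m "last v"]
    by auto
qed

text \<open>Suppose that \<open>v\<close> ends in a run of some letter from position \<open>m + 1\<close> on. If this letter is \<open>b\<close>,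
  the \<open>c\<close> at the end of \<open>w\<close> is incompatible with the run at the start of the words in
  \<open>S\<^sub>m\<^sub>+\<^sub>1(v)\<close> or \<open>S\<^sub>m(w)\<close>, as long as it survives: this forces \<open>j = D\<close>, and no sphere lies between
  \<open>S\<^sub>m(w)\<close> and \<open>S\<^sub>D(w)\<close>. If the letter is \<open>c\<close>, then \<open>S\<^sub>m\<^sub>+\<^sub>1(w)\<close> does lie between them.\<close>
lemma constant_tail_iff:
  assumes "Suc m \<le> j" "j \<le> D" "Suc m < D" "S (Suc m) v \<inter> S j w \<noteq> {}"
  shows "(\<forall>k\<in>{Suc m..D}. letter v k = b) \<longleftrightarrow>
    j = D \<and> subword v (Suc m) (D - 1) = subword v (Suc m + 1) D \<and> walk_sphere2 G m j w \<noteq> {}"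
    (is "?L \<longleftrightarrow> ?M")
proof
  assume L: ?L
  then have last: "last v = b" using letter_D assms by auto
  have w_nth: "w ! n = b" if "m \<le> n" "n < D - 1" for n
    using L[rule_format, of "n + 2"] that v by (simp add: w_def letter_def nth_append nth_tl)
  have w_last: "w ! (D - 1) = c" using last_via_nth[OF w] by simp
  have "j = D"
  proof (rule ccontr)
    assume "j \<noteq> D"
    then have j: "j < D" using assms by simp
    obtain x where x: "x \<in> S (Suc m) v" "x \<in> S j w" using assms by blast
    have "x ! (D - 1 - j) = b"
      using nth_of_mem_S[OF v x(1), of "D - 1 - j"] L[rule_format, of "Suc (Suc m + (D - 1 - j))"] j assms
      by (simp add: letter_def)
    moreover have "x ! (D - 1 - j) = c"
      using nth_of_mem_S[OF w x(2), of "D - 1 - j"] w_last j by simp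
    ultimately show False using c_neq_b by simp
  qed
  moreover have "walk_sphere2 G m D w = S m w"
  proof -
    have "S m w \<subseteq> S D w"
    proof
      fix x assume x: "x \<in> S m w"
      then have xW: "x \<in> W" using S_subset_W[OF w, of m] assms by auto
      have "x ! 0 = b" using nth_of_mem_S[OF w x, of 0] w_nth[of m] assms by simp
      then have "hd x = b" using W_nonempty[OF xW] by (simp add: hd_conv_nth)
      then show "x \<in> S D w"
        using xW w follows_if_neq[OF cb(1,2) c_neq_b] by (simp add: mem_S_iff[OF w])
    qed
    moreover have "\<not> S m w \<subseteq> S l w" if l: "m < l" "l < D" for l
    proof
      assume "S m w \<subseteq> S l w"
      then obtain x where x: "x \<in> S m w" "x \<in> S l w" using S_nonempty[OF w, of m] assms by auto
      have "x ! (D - 1 - l) = b"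
        using nth_of_mem_S[OF w x(1), of "D - 1 - l"] w_nth[of "m + (D - 1 - l)"] l by simp
      moreover have "x ! (D - 1 - l) = c"
        using nth_of_mem_S[OF w x(2), of "D - 1 - l"] w_last l by simp
      ultimately show False using c_neq_b by simp
    qed
    ultimately show ?thesis by (auto simp: walk_sphere2_def)
  qed
  ultimately show ?M
    using subword_eq_iff[OF assms(3)] L last S_nonempty[OF w, of m] assms by simp
next
  assume M: ?M
  then have const: "\<forall>k\<in>{Suc m..D}. letter v k = last v" using subword_eq_iff[OF assms(3)] by simp
  show ?L
  proof (rule ccontr)
    assume "\<not> ?L"
    then have "last v \<noteq> b" using const by auto
    have v_nth: "v ! n = last v" if "m \<le> n" "n < D" for n
      using const[rule_format, of "Suc n"] that by (simp add: letter_def)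
    \<comment> \<open>A run of at least two letters: its letter may follow itself, so it is \<open>b\<close> or \<open>c\<close>.\<close>
    have "R (v ! m) (v ! Suc m)" using successively_W[OF v] v assms(3) by (auto simp: successively_conv_nth)
    then have "R (last v) (last v)" using v_nth[of m] v_nth[of "Suc m"] assms(3) by simp
    then have last: "last v = c"
      using followers_last last_in_A[OF v] \<open>last v \<noteq> b\<close> by auto
    have "m < D" using assms(3) by simp
    have "drop m w = drop m v"
      using const unfolding w_def drop_eq_drop_shift_iff[OF \<open>m < D\<close>] set_drop_letters last .
    have w_nth: "w ! n = c" if n: "m \<le> n" "n < D" for n
    proof -
      have "drop m w ! (n - m) = drop m v ! (n - m)" by (simp only: \<open>drop m w = drop m v\<close>)
      then show ?thesis using n v w v_nth[OF n] last by simp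
    qed
    have rep: "take (D - Suc m) x = drop (Suc m) w" if "x \<in> S m w" for x
    proof -
      have "x \<in> W" using that S_subset_W[OF w, of m] assms by auto
      then show ?thesis
        using nth_of_mem_S[OF w that] w_nth w assms(3)
        by (intro nth_equalityI) simp_all
    qed
    have "S m w \<subseteq> S (Suc m) w"
      using rep S_subset_W[OF w, of m] assms(3) by (auto simp: mem_S_iff[OF w, of "Suc m"])
    moreover have "S (Suc m) w \<subseteq> S D w"
    proof
      fix x assume x: "x \<in> S (Suc m) w"
      then have xW: "x \<in> W" using S_subset_W[OF w, of "Suc m"] assms by auto
      have "hd x = c" using nth_of_mem_S[OF w x, of 0] w_nth[of "Suc m"] assms W_nonempty[OF xW]
        by (simp add: hd_conv_nth)
      then show "x \<in> S D w" using w xW cb(3) last by (simp add: mem_S_iff[OF w])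
    qed
    ultimately have "walk_sphere2 G m D w = {}"
      using assms(3) by (auto simp: walk_sphere2_def)
    then show False using M by metis
  qed
qed

lemma dist_spheres_meet_iff:
  assumes "Suc m \<le> j" "j \<le> D" "Suc m < D"
  shows "Sd (Suc m) v \<inter> Sd j w \<noteq> {} \<longleftrightarrow>
    S (Suc m) v \<inter> S j w \<noteq> {} \<and>
    (\<forall>k. Suc m \<le> k \<and> k < j \<longrightarrow> \<not> S (Suc m) v \<subseteq> walk_sphere2 G k j w) \<and>
    (j < D \<or> j = D \<and> (subword v (Suc m) (D - 1) \<noteq> subword v (Suc m + 1) D \<or>
      walk_sphere2 G m j w = {}))"
proof (cases "S (Suc m) v \<inter> S j w = {}")
  case True
  then show ?thesis using dist_spheres_meet_iff_walk_spheres[OF assms] by simp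
next
  case False
  then have "S (Suc m) v \<subseteq> S j w" using S_subset_if_meets[OF v w] assms by blast
  then show ?thesis
    using dist_spheres_meet_iff_walk_spheres[OF assms] subset_walk_sphere2_iff[OF assms(1,2,3)] constant_tail_iff[OF assms False] assms(2) False
    by (smt (verit) le_neq_implies_less less_irrefl)
qed

end

section \<open>The two families\<close>

lemma (in binary_shift) neighbour_arc:
  assumes "v \<in> W" "w \<in> S 1 v"
  obtains w' c b where "binary_shift_arc R A D v w w' c b"
proof -
  have "S 1 v = (\<Union>a\<in>{a \<in> A. R (last v) a}. {tl v @ [a]})"
    using S_Suc[OF assms(1), of 0] S_0 shift_in_W[OF assms(1)] by auto
  then obtain c where c: "c \<in> {a \<in> A. R (last v) a}" "w = tl v @ [c]" using assms(2) by blast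
  obtain a a' where a: "a \<noteq> a'" "{a \<in> A. R (last v) a} = {a, a'}"
    using followers[OF last_in_A[OF assms(1)]] by metis
  define b where "b = (if c = a then a' else a)"
  have "c \<noteq> b" "{a \<in> A. R (last v) a} = {c, b}"
    using c(1) a by (auto simp: b_def)
  then have "binary_shift_arc R A D v w (tl v @ [b]) c b"
    using assms(1) c(2) by unfold_locales auto
  then show ?thesis by (rule that)
qed

text \<open>Only the De Bruijn digraph has loops. Distinguishing the digraphs as such is necessary because
  the statement treats \<open>G = B(d,D)\<close> and \<open>G = K(d,D)\<close> as complementary cases.\<close>
lemma debruijn_neq_kautz:
  assumes "a \<in> A" "D \<ge> 1"
  shows "debruijn A D \<noteq> kautz B D"
proof
  let ?u = "replicate D a"
  assume "debruijn A D = kautz B D"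
  moreover have "(?u, tl ?u @ [a]) \<in> arcs (debruijn A D)"
    using assms by (auto simp: debruijn_def debruijn_words_def)
  ultimately have "a \<noteq> last ?u \<and> ?u \<in> kautz_words B D" by (auto simp: kautz_def)
  then show False using assms(2) by simp
qed

context binary_shift_arc
begin

lemma letter_w: "letter w D = c"
  using last_via_nth[OF w] by (simp add: letter_def)

text \<open>In the De Bruijn digraph \<open>b\<close> is the letter other than \<open>c = w\<^sub>D\<close>; in the Kautz digraph \<open>b\<close>, \<open>c\<close> and
  \<open>v\<^sub>D\<close> are the three letters. In terms of \<open>b\<close> and \<open>c\<close> the answer is the same for both.\<close>
theorem intersections:
  assumes "1 \<le> i" "i \<le> D"
  shows
    "(\<forall>j. i = D \<and> j = D \<longrightarrow>
        (Sd i v \<inter> Sd j w \<noteq> {} \<longleftrightarrow> letter v D \<noteq> b))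
     \<and>
     (\<forall>j. i \<le> j \<and> j \<le> D \<and> i \<noteq> D \<longrightarrow>
        (Sd i v \<inter> Sd j w \<noteq> {} \<longleftrightarrow>
           S i v \<inter> S j w \<noteq> {} \<and>
           (\<forall>k. i \<le> k \<and> k < j \<longrightarrow> \<not> S i v \<subseteq> walk_sphere2 G k j w) \<and>
           (j < D \<or>
            j = D \<and> (subword v i (D - 1) \<noteq> subword v (i + 1) D \<or>
                     walk_sphere2 G (i - 1) j w = {}))))
     \<and>
     ((Sd i v \<inter> Sd (i - 1) w = {} \<longleftrightarrow> (\<forall>k\<in>{i..D}. letter v k = c)) \<and>
      (Sd i v \<inter> Sd (i - 1) w = {} \<longrightarrow> Sd i v \<inter> Sd i w \<noteq> {}))
     \<and>
     ((\<forall>j. i \<le> j \<and> j \<le> D \<longrightarrow> Sd i v \<inter> Sd j w = {}) \<longleftrightarrow>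
        (\<forall>k\<in>{i..D}. letter v k = b))"
proof -
  obtain m where i: "i = Suc m" using assms(1) by (cases i) auto
  then have m: "m < D" using assms(2) by simp
  have "i < D" if "i \<noteq> D" using that assms(2) by simp
  then show ?thesis
    using dist_spheres_meet_at_diameter dist_spheres_meet_iff[of m] dist_spheres_meet_if_near_empty[OF m] far_dist_spheres_empty_iff[OF m] fresh_w_empty_iff[OF m] Sd_inter_near[OF m]
    unfolding i letter_D by (intro conjI allI impI) simp_all
qed

end

theorem proposition4:
  fixes d D i :: nat
    and G :: "('a list, 'a list \<times> 'a list) pre_digraph"
    and v w :: "'a list"
  assumes "d = 2" and "D \<ge> 1"
    and "is_debruijn d D G \<or> is_kautz d D G"
    and "v \<in> verts G"
    and "w \<in> walk_sphere G 1 v"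
    and "1 \<le> i" and "i \<le> D"
  shows
    "(\<forall>j. i = D \<and> j = D \<longrightarrow>
        (dist_sphere G i v \<inter> dist_sphere G j w \<noteq> {} \<longleftrightarrow>
           is_kautz d D G \<or> letter v D = letter w D))
     \<and>
     (\<forall>j. i \<le> j \<and> j \<le> D \<and> i \<noteq> D \<longrightarrow>
        (dist_sphere G i v \<inter> dist_sphere G j w \<noteq> {} \<longleftrightarrow>
           walk_sphere G i v \<inter> walk_sphere G j w \<noteq> {} \<and>
           (\<forall>k. i \<le> k \<and> k < j \<longrightarrow> \<not> walk_sphere G i v \<subseteq> walk_sphere2 G k j w) \<and>
           (j < D \<or>
            j = D \<and> (subword v i (D - 1) \<noteq> subword v (i + 1) D \<or>
                     walk_sphere2 G (i - 1) j w = {}))))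
     \<and>
     ((dist_sphere G i v \<inter> dist_sphere G (i - 1) w = {} \<longleftrightarrow>
         is_debruijn d D G \<and> (\<forall>k\<in>{i..D}. letter v k = letter w D)) \<and>
      (dist_sphere G i v \<inter> dist_sphere G (i - 1) w = {} \<longrightarrow>
         dist_sphere G i v \<inter> dist_sphere G i w \<noteq> {}))
     \<and>
     ((\<forall>j. i \<le> j \<and> j \<le> D \<longrightarrow> dist_sphere G i v \<inter> dist_sphere G j w = {}) \<longleftrightarrow>
        is_debruijn d D G \<and> (\<forall>k\<in>{i..D}. letter v k = letter v D) \<and>
        letter v D \<noteq> letter w D)"
proof -
  note i = \<open>1 \<le> i\<close> \<open>i \<le> D\<close>
  from assms(3) show ?thesis
  proof
    assume B: "is_debruijn d D G"
    then obtain A where A: "finite A" "card A = 2" and G: "G = shift_digraph (\<lambda>_ _. True) A D"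
      using \<open>d = 2\<close> by (auto simp: is_debruijn_def debruijn_eq_shift)
    interpret binary_shift "\<lambda>_ _. True" A D
      using A \<open>D \<ge> 1\<close> by unfold_locales auto
    have v: "v \<in> W" using assms(4) verts_G G by simp
    obtain w' c b where arc: "binary_shift_arc (\<lambda>_ _. True) A D v w w' c b"
      using neighbour_arc[OF v] assms(5) unfolding G by blast
    interpret binary_shift_arc "\<lambda>_ _. True" A D v w w' c b by (rule arc)
    have "A = {c, b}" using followers_last by simp
    then have two: "letter v D = c \<or> letter v D = b" using last_in_A[OF v] letter_D by auto
    obtain a where "a \<in> A" using A(2) by fastforce
    then have K: "\<not> is_kautz d D G"
      using debruijn_neq_kautz[of a A D] \<open>D \<ge> 1\<close> by (auto simp: is_kautz_def G debruijn_eq_shift)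
    have "letter v D \<noteq> b \<longleftrightarrow> letter v D = c" using two c_neq_b by auto
    moreover have "(\<forall>k\<in>{i..D}. letter v k = b) \<longleftrightarrow>
        (\<forall>k\<in>{i..D}. letter v k = letter v D) \<and> letter v D \<noteq> c"
      using two c_neq_b \<open>i \<le> D\<close> by auto
    ultimately show ?thesis
      using intersections[OF i] B K unfolding G letter_w by (simp only:) simp
  next
    assume K: "is_kautz d D G"
    then obtain A where A: "finite A" "card A = 3" and G: "G = shift_digraph (\<noteq>) A D"
      using \<open>d = 2\<close> by (auto simp: is_kautz_def kautz_eq_shift)
    have "card {b \<in> A. a \<noteq> b} = 2" if "a \<in> A" for a
    proof -
      have "{b \<in> A. a \<noteq> b} = A - {a}" by auto
      then show ?thesis using that A by simp
    qed
    then interpret binary_shift "(\<noteq>)" A D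
      using \<open>D \<ge> 1\<close> by unfold_locales auto
    have v: "v \<in> W" using assms(4) verts_G G by simp
    obtain w' c b where arc: "binary_shift_arc (\<noteq>) A D v w w' c b"
      using neighbour_arc[OF v] assms(5) unfolding G by blast
    interpret binary_shift_arc "(\<noteq>)" A D v w w' c b by (rule arc)
    have neq: "letter v D \<noteq> c" "letter v D \<noteq> b" using cb letter_D by auto
    have B: "\<not> is_debruijn d D G"
    proof
      assume "is_debruijn d D G"
      then obtain A' where A': "card A' = 2" "G = debruijn A' D"
        using \<open>d = 2\<close> by (auto simp: is_debruijn_def)
      then obtain a where "a \<in> A'" by fastforce
      then show False
        using debruijn_neq_kautz[of a A' D A] \<open>D \<ge> 1\<close> A'(2) by (simp add: G kautz_eq_shift)
    qed
    have "\<not> (\<forall>k\<in>{i..D}. letter v k = c)" "\<not> (\<forall>k\<in>{i..D}. letter v k = b)"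
      using neq \<open>i \<le> D\<close> by auto
    then show ?thesis
      using intersections[OF i] B K neq unfolding G letter_w by (simp only:) simp
  qed
qed

end
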